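(* Let $H$ be a Heyting algebra and let $M$ be a Heyting module over $H$. Then the collection of hereditary submodules of $M$, equipped with the subspace topology induced by $Sub(M)$, forms a spectral space.
   Context: Lattices have all finite meets and joins (hence a least element $0$ and a greatest element $1$). A join semilattice is a poset in which every finite subset, including the empty one, has a join; its least element is $0$. For a distributive lattice $L$, a distributive module over $L$ is a join semilattice $M$ with an action $L\times M\to M$, $(x,m)\mapsto x\wedge m$, order preserving in both variables, such that $1\wedge m=m$, $0\wedge m=0$, $(x\wedge y)\wedge m=x\wedge(y\wedge m)$, $(x\vee y)\wedge m=(x\wedge m)\vee(y\wedge m)$, $x\wedge(m\vee n)=(x\wedge m)\vee(x\wedge n)$. A Heyting algebra $H$ (not assumed finite here) is a lattice such that for all $y,z\in H$ there is $(y\to z)_H\in H$ with $x\wedge y\le z\Leftrightarrow x\le (y\to z)_H$ for all $x\in H$. A Heyting module over $H$ is a distributive module $M$ over $H$ such that for all $m,n\in M$ there is $(m\to n)_M\in H$ with $x\wedge m\le n\Leftrightarrow x\le(m\to n)_M$ for all $x\in H$. A Heyting submodule of $M$ is a subset closed under finite joins (so containing $0$) and under the action of $H$; $Sub(M)$ is the set of Heyting submodules of $M$. A hereditary submodule of $M$ is a sub-join-semilattice $N\subseteq M$ (closed under finite joins, containing $0$) such that $n\in N$ and $n'\le n$ imply $n'\in N$; it is automatically a Heyting submodule. $Sub(M)$ carries the topology whose subbasis of closed sets consists of the sets $V(m_1,\dots,m_n)=\{N\in Sub(M) : m_1,\dots,m_n\in N\}$ for finite collections $m_1,\dots,m_n\in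 M$. A topological space is spectral if it is homeomorphic to the Zariski spectrum of a commutative ring; equivalently (Hochster) it is quasi-compact, its quasi-compact open subsets are closed under (finite) intersection and form a basis, and every non-empty irreducible closed subset has a unique generic point. *)

theory Defs
  imports "HOL-Analysis.Analysis"
begin

section \<open>Heyting algebras and Heyting modules\<close>

text \<open>Distributivity is not assumed; it follows from the existence of the residuals.\<close>

class heyting_algebra = bounded_lattice +
  assumes ex_heyting_imp: "\<exists>w. \<forall>x. inf x y \<le> z \<longleftrightarrow> x \<le> w"
begin

subclass distrib_lattice
proof
  have "inf x (sup y z) = sup (inf x y) (inf x z)" for x y z
  proof (rule order.antisym)
    obtain w where w: "\<And>u. inf u x \<le> sup (inf x y) (inf x z) \<longleftrightarrow> u \<le> w"
      using ex_heyting_imp by blast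
    have "y \<le> w" "z \<le> w"
      using w[of y] w[of z] by (simp_all add: inf_commute)
    then have "sup y z \<le> w" by simp
    then show "inf x (sup y z) \<le> sup (inf x y) (inf x z)"
      using w[of "sup y z"] by (simp add: inf_commute)
    show "sup (inf x y) (inf x z) \<le> inf x (sup y z)"
      by (simp add: le_infI2)
  qed
  then show "sup x (inf y z) = inf (sup x y) (sup x z)" for x y z
    by (rule distrib_imp1)
qed

end

locale distributive_module =
  fixes act :: "'h::{distrib_lattice,bounded_lattice} \<Rightarrow> 'm::bounded_semilattice_sup_bot \<Rightarrow> 'm"
    (infixr "\<odot>" 70)
  assumes act_mono_left: "x \<le> y \<Longrightarrow> x \<odot> m \<le> y \<odot> m"
    and act_mono_right: "m \<le> n \<Longrightarrow> x \<odot> m \<le> x \<odot> n"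
    and act_top: "top \<odot> m = m"
    and act_bot: "bot \<odot> m = bot"
    and act_inf: "inf x y \<odot> m = x \<odot> (y \<odot> m)"
    and act_sup_left: "sup x y \<odot> m = sup (x \<odot> m) (y \<odot> m)"
    and act_sup_right: "x \<odot> sup m n = sup (x \<odot> m) (x \<odot> n)"

locale heyting_module = distributive_module act
  for act :: "'h::heyting_algebra \<Rightarrow> 'm::bounded_semilattice_sup_bot \<Rightarrow> 'm" (infixr "\<odot>" 70) +
  assumes ex_module_imp: "\<exists>w. \<forall>x. x \<odot> m \<le> n \<longleftrightarrow> x \<le> w"


section \<open>Submodules\<close>

definition sub_join_semilattice :: "'m::bounded_semilattice_sup_bot set \<Rightarrow> bool" where
  "sub_join_semilattice N \<longleftrightarrow> bot \<in> N \<and> (\<forall>m\<in>N. \<forall>n\<in>N. sup m n \<in> N)"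

definition heyting_submodules ::
    "('h::heyting_algebra \<Rightarrow> 'm::bounded_semilattice_sup_bot \<Rightarrow> 'm) \<Rightarrow> 'm set set" where
  "heyting_submodules act = {N. sub_join_semilattice N \<and> (\<forall>x. \<forall>n\<in>N. act x n \<in> N)}"

definition hereditary_submodules :: "'m::bounded_semilattice_sup_bot set set" where
  "hereditary_submodules = {N. sub_join_semilattice N \<and> (\<forall>n\<in>N. \<forall>n'\<le>n. n' \<in> N)}"

lemma (in heyting_module) hereditary_submodules_subset:
  "hereditary_submodules \<subseteq> heyting_submodules act"
proof -
  have "x \<odot> n \<le> n" for x n
    using act_mono_left[of x top n] by (simp add: act_top)
  then show ?thesis
    unfolding hereditary_submodules_def heyting_submodules_def by blast
qed


section \<open>The topology on the set of Heyting submodules\<close>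

definition submodules_containing ::
    "('h::heyting_algebra \<Rightarrow> 'm::bounded_semilattice_sup_bot \<Rightarrow> 'm) \<Rightarrow> 'm set \<Rightarrow> 'm set set" where
  "submodules_containing act F = {N \<in> heyting_submodules act. F \<subseteq> N}"

text \<open>The whole space is inserted explicitly because \<open>topology_generated_by\<close> takes
  the union of the given sets as its carrier, and the full module lies in every
  \<open>submodules_containing\<close>, hence in none of the complements.\<close>

definition submodule_topology ::
    "('h::heyting_algebra \<Rightarrow> 'm::bounded_semilattice_sup_bot \<Rightarrow> 'm) \<Rightarrow> 'm set topology" where
  "submodule_topology act =
     topology_generated_by
       (insert (heyting_submodules act)
          {heyting_submodules act - submodules_containing act F | F. finite F})"

lemma topspace_submodule_topology:
  "topspace (submodule_topology act) = heyting_submodules act"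
  unfolding submodule_topology_def by auto

lemma (in heyting_module) topspace_hereditary_submodules:
  "topspace (subtopology (submodule_topology act) hereditary_submodules) = hereditary_submodules"
  using hereditary_submodules_subset by (auto simp: topspace_submodule_topology)


section \<open>Spectral spaces\<close>

definition irreducible_closedin :: "'a topology \<Rightarrow> 'a set \<Rightarrow> bool" where
  "irreducible_closedin X C \<longleftrightarrow>
     closedin X C \<and> C \<noteq> {} \<and>
     (\<forall>A B. closedin X A \<and> closedin X B \<and> C = A \<union> B \<longrightarrow> C = A \<or> C = B)"

text \<open>Spectral spaces in Hochster's topological form: by his theorem these are exactly the
  spaces homeomorphic to the Zariski spectrum of a commutative ring.\<close>

definition spectral_space :: "'a topology \<Rightarrow> bool" where
  "spectral_space X \<longleftrightarrow>
     compact_space X \<and>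
     (\<forall>U V. openin X U \<and> compactin X U \<and> openin X V \<and> compactin X V
        \<longrightarrow> compactin X (U \<inter> V)) \<and>
     openin X = arbitrary union_of (\<lambda>U. openin X U \<and> compactin X U) \<and>
     (\<forall>C. irreducible_closedin X C \<longrightarrow> (\<exists>!x. x \<in> C \<and> X closure_of {x} = C))"

end

theory Submission
  imports Defs
begin

text \<open>
  On the hereditary submodules the sets of all \<open>N\<close> disjoint from a finite set \<open>F\<close> form a basis
  closed under finite intersections. They are compact by Alexander's subbase lemma: if the sets
  \<open>{N. m \<notin> N}\<close> with \<open>m \<in> A\<close> cover such a basic set, then the hereditary submodule generated by
  \<open>A\<close> meets \<open>F\<close>, and membership of an element of \<open>F\<close> in it involves only finitely many elements
  of \<open>A\<close>. The closure of a point \<open>I\<close> consists of the hereditary submodules containing \<open>I\<close>, and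
  the generic point of an irreducible closed set is its intersection.
\<close>

text \<open>This is the trace of the intersection over \<open>m \<in> F\<close> of the complements
  of \<open>submodules_containing act {m}\<close>. The complement of
  \<open>submodules_containing act F\<close> instead has as its trace the union of the sets
  \<open>avoiding {m}\<close>.\<close>

definition avoiding :: "'m::bounded_semilattice_sup_bot set \<Rightarrow> 'm set set" where
  "avoiding F = {N \<in> hereditary_submodules. F \<inter> N = {}}"

lemma avoiding_Int: "avoiding F \<inter> avoiding G = avoiding (F \<union> G)"
  by (auto simp: avoiding_def)

lemma avoiding_empty: "avoiding {} = hereditary_submodules"
  by (simp add: avoiding_def)

lemma Inter_hereditary_submodules:
  "\<N> \<subseteq> hereditary_submodules \<Longrightarrow> \<Inter>\<N> \<in> hereditary_submodules"
  unfolding hereditary_submodules_def sub_join_semilattice_def by blast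

text \<open>This is the hereditary submodule generated by \<open>A\<close>, written so that
  membership has a finite witness \<open>T\<close>; compactness rests on that form. The union of two
  witnesses serves for a join, and a smaller element keeps its witness.\<close>

lemma hereditary_submodules_finitary_hull:
  fixes A :: "'m::bounded_semilattice_sup_bot set"
  shows "{n. \<exists>T. finite T \<and> T \<subseteq> A \<and> (\<forall>N\<in>hereditary_submodules. T \<subseteq> N \<longrightarrow> n \<in> N)}
    \<in> hereditary_submodules"  (is "?I \<in> _")
proof -
  have bot: "bot \<in> N" and sup: "\<And>m n. m \<in> N \<Longrightarrow> n \<in> N \<Longrightarrow> sup m n \<in> N"
    and down: "\<And>m n. m \<in> N \<Longrightarrow> n \<le> m \<Longrightarrow> n \<in> N"
    if "N \<in> hereditary_submodules" for N :: "'m set"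
    using that unfolding hereditary_submodules_def sub_join_semilattice_def by blast+
  have "bot \<in> ?I"
    using bot by blast
  moreover have "sup m n \<in> ?I" if mn: "m \<in> ?I" "n \<in> ?I" for m n
  proof -
    obtain S T where "finite S" "S \<subseteq> A" "\<forall>N\<in>hereditary_submodules. S \<subseteq> N \<longrightarrow> m \<in> N"
      and "finite T" "T \<subseteq> A" "\<forall>N\<in>hereditary_submodules. T \<subseteq> N \<longrightarrow> n \<in> N"
      using mn by blast
    then have "finite (S \<union> T) \<and> S \<union> T \<subseteq> A \<and>
        (\<forall>N\<in>hereditary_submodules. S \<union> T \<subseteq> N \<longrightarrow> sup m n \<in> N)"
      using sup by auto
    then show ?thesis by blast
  qed
  moreover have "n \<in> ?I" if mn: "m \<in> ?I" "n \<le> m" for m n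
  proof -
    obtain T where "finite T" "T \<subseteq> A" "\<forall>N\<in>hereditary_submodules. T \<subseteq> N \<longrightarrow> m \<in> N"
      using mn(1) by blast
    then have "finite T \<and> T \<subseteq> A \<and> (\<forall>N\<in>hereditary_submodules. T \<subseteq> N \<longrightarrow> n \<in> N)"
      using down mn(2) by auto
    then show ?thesis by blast
  qed
  ultimately have "sub_join_semilattice ?I \<and> (\<forall>n\<in>?I. \<forall>n'\<le>n. n' \<in> ?I)"
    unfolding sub_join_semilattice_def by (intro conjI ballI allI impI)
  \<comment> \<open>\<open>?I\<close> itself mentions \<open>hereditary_submodules\<close>; only the
    outer occurrence is expanded.\<close>
  then show ?thesis
    by (subst hereditary_submodules_def) (rule CollectI)
qed

text \<open>Induction extends the two-set condition to finite covers; the empty cover is excluded by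
  \<open>C \<noteq> {}\<close>.\<close>

lemma irreducible_closedin_finite_Union:
  assumes C: "irreducible_closedin X C" and "finite \<A>"
    and "\<And>A. A \<in> \<A> \<Longrightarrow> closedin X A" and "C \<subseteq> \<Union>\<A>"
  shows "\<exists>A\<in>\<A>. C \<subseteq> A"
  using assms(2-)
proof (induction \<A>)
  case empty
  then show ?case
    using C by (simp add: irreducible_closedin_def)
next
  case (insert A \<A>)
  \<comment> \<open>Irreducibility speaks of \<open>C\<close> as equal to a union, so the covering
    sets are first cut down to \<open>C\<close>.\<close>
  have closed: "closedin X (C \<inter> A)" "closedin X (C \<inter> \<Union>\<A>)"
    using C insert by (auto simp: irreducible_closedin_def intro!: closedin_Int closedin_Union)
  moreover have "C = (C \<inter> A) \<union> (C \<inter> \<Union>\<A>)"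
    using insert.prems by blast
  ultimately have "C = C \<inter> A \<or> C = C \<inter> \<Union>\<A>"
    using C unfolding irreducible_closedin_def by blast
  then show ?case
  proof
    assume "C = C \<inter> A"
    then show ?thesis by blast
  next
    assume "C = C \<inter> \<Union>\<A>"
    then have "C \<subseteq> \<Union>\<A>" by (simp only: inf.absorb_iff1)
    then have "\<exists>A\<in>\<A>. C \<subseteq> A"
      using insert.IH insert.prems(1) by simp
    then show ?thesis by simp
  qed
qed

section \<open>The topology on hereditary submodules: basis and compactness\<close>

context heyting_module
begin

abbreviation hereditary_topology :: "'m set topology" where
  "hereditary_topology \<equiv> subtopology (submodule_topology act) hereditary_submodules"

lemma openin_avoiding:
  assumes "finite F"
  shows "openin hereditary_topology (avoiding F)"
  using assms
proof (induction F)
  case empty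
  then show ?case
    by (metis avoiding_empty openin_topspace topspace_hereditary_submodules)
next
  case (insert m F)
  have "openin (submodule_topology act)
      (heyting_submodules act - submodules_containing act {m})"
    unfolding submodule_topology_def by (rule topology_generated_by_Basis) blast
  then have "openin hereditary_topology
      ((heyting_submodules act - submodules_containing act {m}) \<inter> hereditary_submodules)"
    by (rule openin_subtopology_Int)
  also have "(heyting_submodules act - submodules_containing act {m}) \<inter> hereditary_submodules
      = avoiding {m}"
    using hereditary_submodules_subset by (auto simp: submodules_containing_def avoiding_def)
  finally show ?case
    using insert.IH openin_Int avoiding_Int[of "{m}" F] by fastforce
qed

text \<open>An open set is the trace of a generated set \<open>W\<close>. Induction on the
  generation of \<open>W\<close> gives each hereditary \<open>N \<in> W\<close> a basic
  neighbourhood inside \<open>W\<close>; binary intersections are handled by uniting the two finite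
  index sets.\<close>

lemma openin_hereditary_topology:
  "openin hereditary_topology = arbitrary union_of (\<lambda>U. \<exists>F. finite F \<and> U = avoiding F)"
proof (intro ext iffI)
  fix U
  assume "openin hereditary_topology U"
  then obtain W where W: "U = W \<inter> hereditary_submodules"
    and gen: "generate_topology_on (insert (heyting_submodules act)
          {heyting_submodules act - submodules_containing act F | F. finite F}) W"
    unfolding openin_subtopology submodule_topology_def openin_topology_generated_by_iff by blast
  have "\<exists>F. finite F \<and> N \<in> avoiding F \<and> avoiding F \<subseteq> W"
    if "N \<in> W" "N \<in> hereditary_submodules" for N
    using gen that
  proof (induction W)
    case Empty
    then show ?case by simp
  next
    case (Int a b)
    then obtain F G where "finite F" "N \<in> avoiding F" "avoiding F \<subseteq> a"
      and "finite G" "N \<in> avoiding G" "avoiding G \<subseteq> b"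
      by blast
    then show ?case
      by (intro exI[of _ "F \<union> G"]) (auto simp flip: avoiding_Int)
  next
    case (UN K)
    then show ?case by (meson UnionE Union_upper subset_trans)
  next
    case (Basis s)
    then consider "s = heyting_submodules act"
      | F where "s = heyting_submodules act - submodules_containing act F"
      by blast
    then show ?case
    proof cases
      case 1
      then show ?thesis
        using Basis hereditary_submodules_subset
        by (intro exI[of _ "{}"]) (auto simp: avoiding_empty)
    next
      case 2
      \<comment> \<open>One element of \<open>F\<close> missing from \<open>N\<close> suffices: no
        submodule in \<open>avoiding {m}\<close> contains \<open>F\<close>.\<close>
      then obtain m where "m \<in> F" "m \<notin> N"
        using Basis by (auto simp: submodules_containing_def)
      then show ?thesis
        using Basis 2 hereditary_submodules_subset
        by (intro exI[of _ "{m}"]) (auto simp: avoiding_def submodules_containing_def)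
    qed
  qed
  moreover have "avoiding F \<subseteq> hereditary_submodules" for F :: "'m set"
    by (auto simp: avoiding_def)
  ultimately have "\<exists>F. finite F \<and> N \<in> avoiding F \<and> avoiding F \<subseteq> U" if "N \<in> U" for N
    using that unfolding W by (meson IntE Int_greatest)
  then show "(arbitrary union_of (\<lambda>U. \<exists>F. finite F \<and> U = avoiding F)) U"
    unfolding arbitrary_union_of_alt by blast
next
  fix U :: "'m set set"
  assume "(arbitrary union_of (\<lambda>U. \<exists>F. finite F \<and> U = avoiding F)) U"
  then show "openin hereditary_topology U"
    unfolding union_of_def using openin_avoiding by (auto intro!: openin_Union)
qed

lemma compactin_avoiding:
  assumes "finite G"
  shows "compactin hereditary_topology (avoiding G)"
proof -
  \<comment> \<open>Alexander's lemma asks that \<open>\<B>\<close> cover \<open>avoiding G\<close>.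
    For empty \<open>G\<close> this set contains the full module, which lies in no
    \<open>{N. m \<notin> N}\<close>; hence \<open>UNIV\<close> is added.\<close>
  define \<B> :: "'m set set set" where "\<B> = insert UNIV (range (\<lambda>m. {N. m \<notin> N}))"
  \<comment> \<open>Finite intersections from the subbase \<open>\<B>\<close> have the same traces
    on \<open>avoiding G\<close> as the basic sets, which presents the subspace topology in the form
    Alexander's lemma requires.\<close>
  have eq: "(\<lambda>U. \<exists>F. finite F \<and> U = avoiding F) relative_to avoiding G
      = (finite intersection_of (\<lambda>x. x \<in> \<B>)) relative_to avoiding G" (is "?P = ?Q")
  proof (intro ext iffI)
    fix U
    assume "?P U"
    then obtain F where F: "finite F" "U = avoiding G \<inter> avoiding F"
      by (auto simp: relative_to_def)
    have "(finite intersection_of (\<lambda>x. x \<in> \<B>)) (\<Inter>m\<in>F. {N. m \<notin> N})"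
      unfolding intersection_of_def using F
      by (intro exI[of _ "(\<lambda>m. {N. m \<notin> N}) ` F"]) (auto simp: \<B>_def)
    moreover have "U = avoiding G \<inter> (\<Inter>m\<in>F. {N. m \<notin> N})"
      using F by (auto simp: avoiding_def)
    ultimately show "?Q U"
      by (auto simp: relative_to_def)
  next
    fix U
    assume "?Q U"
    then obtain \<T> where \<T>: "finite \<T>" "\<T> \<subseteq> \<B>" "U = avoiding G \<inter> \<Inter>\<T>"
      by (auto simp: relative_to_def intersection_of_def)
    have "\<exists>F. finite F \<and> avoiding G \<inter> \<Inter>\<T> = avoiding G \<inter> avoiding F"
      using \<T>(1,2)
    proof (induction \<T>)
      case empty
      show ?case
        by (intro exI[of _ "{}"]) (auto simp: avoiding_def)
    next
      case (insert B \<T>)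
      then obtain F where F: "finite F" "avoiding G \<inter> \<Inter>\<T> = avoiding G \<inter> avoiding F"
        by blast
      have "B \<in> \<B>" using insert.prems by simp
      then consider "B = UNIV" | m where "B = {N. m \<notin> N}"
        by (auto simp: \<B>_def)
      then show ?case
      proof cases
        case 1
        then show ?thesis using F by auto
      next
        case 2
        have "avoiding G \<inter> \<Inter>(insert B \<T>) = avoiding G \<inter> avoiding F \<inter> B"
          using F(2) by auto
        also have "\<dots> = avoiding G \<inter> avoiding (insert m F)"
          using 2 by (auto simp: avoiding_def)
        finally show ?thesis
          using F(1) by blast
      qed
    qed
    then show "?P U"
      using \<T>(3) by (auto simp: relative_to_def)
  qed
  have "compact_space (subtopology hereditary_topology (avoiding G))"
  proof (rule Alexander_subbase_alt)
    show "avoiding G \<subseteq> \<Union>\<B>"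
      by (simp add: \<B>_def)
    have "openin (subtopology hereditary_topology (avoiding G))
        = arbitrary union_of (finite intersection_of (\<lambda>x. x \<in> \<B>) relative_to avoiding G)"
      unfolding openin_relative_to[of hereditary_topology, symmetric] openin_hereditary_topology
        arbitrary_union_of_relative_to eq ..
    then show "topology (arbitrary union_of (finite intersection_of (\<lambda>x. x \<in> \<B>) relative_to avoiding G))
        = subtopology hereditary_topology (avoiding G)"
      by (metis openin_inverse)
  next
    fix \<C>
    assume \<C>: "\<C> \<subseteq> \<B>" and cover: "avoiding G \<subseteq> \<Union>\<C>"
    show "\<exists>\<C>'. finite \<C>' \<and> \<C>' \<subseteq> \<C> \<and> avoiding G \<subseteq> \<Union>\<C>'"
    proof (cases "UNIV \<in> \<C>")
      case True
      then show ?thesis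
        by (intro exI[of _ "{UNIV}"]) auto
    next
      case False
      define A where "A = {m. {N. m \<notin> N} \<in> \<C>}"
      define I where
        "I = {n. \<exists>T. finite T \<and> T \<subseteq> A \<and> (\<forall>N\<in>hereditary_submodules. T \<subseteq> N \<longrightarrow> n \<in> N)}"
      have "I \<in> hereditary_submodules"
        unfolding I_def by (rule hereditary_submodules_finitary_hull)
      moreover have "I \<notin> \<Union>\<C>"
      proof
        assume "I \<in> \<Union>\<C>"
        then obtain m where "m \<in> A" "m \<notin> I"
          using \<C> False unfolding \<B>_def A_def by blast
        \<comment> \<open>The singleton \<open>{m}\<close> is a finite witness for
          \<open>m \<in> I\<close>.\<close>
        then show False
          unfolding I_def by (auto dest: spec[of _ "{m}"])
      qed
      \<comment> \<open>The hereditary submodule \<open>I\<close> is left uncovered, so it cannot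
        belong to \<open>avoiding G\<close>.\<close>
      ultimately obtain g where "g \<in> G" "g \<in> I"
        using cover unfolding avoiding_def by blast
      then obtain T where T: "finite T" "T \<subseteq> A"
        "\<And>N. N \<in> hereditary_submodules \<Longrightarrow> T \<subseteq> N \<Longrightarrow> g \<in> N"
        unfolding I_def by blast
      \<comment> \<open>A member of \<open>avoiding G\<close> misses \<open>g\<close>, so it cannot
        contain all of \<open>T\<close>.\<close>
      have "avoiding G \<subseteq> (\<Union>m\<in>T. {N. m \<notin> N})"
        using T(3) \<open>g \<in> G\<close> by (auto simp: avoiding_def)
      then show ?thesis
        using T(1,2) by (intro exI[of _ "(\<lambda>m. {N. m \<notin> N}) ` T"]) (auto simp: A_def)
    qed
  qed
  then show ?thesis
    using openin_subset[OF openin_avoiding[OF assms]] by (simp only: compactin_subspace)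
qed

text \<open>A compact open set is a finite union of basic sets. Distributing the intersection leaves
  finitely many sets \<open>avoiding (F \<union> G)\<close>, each compact.\<close>

lemma compactin_hereditary_topology_Int:
  assumes U: "openin hereditary_topology U" "compactin hereditary_topology U"
    and V: "openin hereditary_topology V" "compactin hereditary_topology V"
  shows "compactin hereditary_topology (U \<inter> V)"
proof -
  have fin: "\<exists>\<F>. finite \<F> \<and> (\<forall>F\<in>\<F>. finite F) \<and> W = \<Union>(avoiding ` \<F>)"
    if W: "openin hereditary_topology W" "compactin hereditary_topology W" for W
  proof -
    obtain \<U> where \<U>: "\<forall>U\<in>\<U>. \<exists>F. finite F \<and> U = avoiding F" "\<Union>\<U> = W"
      using W(1) unfolding openin_hereditary_topology union_of_def by blast
    then obtain \<V> where \<V>: "finite \<V>" "\<V> \<subseteq> \<U>" "W \<subseteq> \<Union>\<V>"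
      using W(2) openin_avoiding unfolding compactin_def by (metis order_refl)
    obtain f where f: "\<forall>U\<in>\<U>. finite (f U) \<and> U = avoiding (f U)"
      using \<U>(1) by metis
    have "\<Union>(avoiding ` f ` \<V>) = \<Union>\<V>"
      using f \<V>(2) by (metis (no_types, lifting) image_image image_cong image_ident subsetD)
    moreover have "\<Union>\<V> = W"
      using \<V> \<U> by blast
    ultimately show ?thesis
      using f \<V> by (intro exI[of _ "f ` \<V>"]) auto
  qed
  obtain \<F> \<G> where "finite \<F>" "\<forall>F\<in>\<F>. finite F" "U = \<Union>(avoiding ` \<F>)"
    and "finite \<G>" "\<forall>G\<in>\<G>. finite G" "V = \<Union>(avoiding ` \<G>)"
    using fin[OF U] fin[OF V] by blast
  moreover from this have "U \<inter> V = \<Union>((\<lambda>(F, G). avoiding (F \<union> G)) ` (\<F> \<times> \<G>))"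
    by (auto simp flip: avoiding_Int)
  moreover have "compactin hereditary_topology (\<Union>((\<lambda>(F, G). avoiding (F \<union> G)) ` (\<F> \<times> \<G>)))"
    using calculation by (intro compactin_Union) (auto intro: compactin_avoiding)
  ultimately show ?thesis
    by simp
qed

section \<open>Closures of points and generic points\<close>

lemma closure_of_hereditary_submodule:
  assumes "I \<in> hereditary_submodules"
  shows "hereditary_topology closure_of {I} = {N \<in> hereditary_submodules. I \<subseteq> N}"
proof (intro subset_antisym subsetI)
  fix N
  assume N: "N \<in> hereditary_topology closure_of {I}"
  then have N': "N \<in> hereditary_submodules"
    unfolding in_closure_of topspace_hereditary_submodules by simp
  have "m \<in> N" if "m \<in> I" for m
  proof (rule ccontr)
    assume "m \<notin> N"
    then have "N \<in> avoiding {m}"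
      using N' by (simp add: avoiding_def)
    then have "I \<in> avoiding {m}"
      using N openin_avoiding[of "{m}"] unfolding in_closure_of by blast
    then show False
      using that by (simp add: avoiding_def)
  qed
  then show "N \<in> {N \<in> hereditary_submodules. I \<subseteq> N}"
    using N' by blast
next
  fix N
  assume N: "N \<in> {N \<in> hereditary_submodules. I \<subseteq> N}"
  \<comment> \<open>A set \<open>F\<close> disjoint from \<open>N\<close> is disjoint from the
    smaller \<open>I\<close>, so every basic neighbourhood of \<open>N\<close> contains
    \<open>I\<close>.\<close>
  have "I \<in> U" if U: "openin hereditary_topology U" "N \<in> U" for U
  proof -
    obtain F :: "'m set" where "N \<in> avoiding F" "avoiding F \<subseteq> U"
      using U unfolding openin_hereditary_topology arbitrary_union_of_alt by blast
    then show ?thesis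
      using N assms by (auto simp: avoiding_def)
  qed
  then show "N \<in> hereditary_topology closure_of {I}"
    using N unfolding in_closure_of topspace_hereditary_submodules by blast
qed

text \<open>Otherwise some basic neighbourhood \<open>avoiding F\<close> of \<open>\<Inter>C\<close>
  misses \<open>C\<close>, so every member of \<open>C\<close> contains an element of
  \<open>F\<close>. The finitely many closed sets given by \<open>m \<in> N\<close> with
  \<open>m \<in> F\<close> then cover \<open>C\<close>. Irreducibility puts \<open>C\<close> inside
  one of them, so that \<open>m\<close> lies in \<open>\<Inter>C\<close>, which is disjoint from
  \<open>F\<close>.\<close>

lemma irreducible_closedin_hereditary_topology_Inter:
  assumes C: "irreducible_closedin hereditary_topology C"
  shows "\<Inter>C \<in> C"
proof (rule ccontr)
  assume notin: "\<Inter>C \<notin> C"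
  have closed: "closedin hereditary_topology C" and ne: "C \<noteq> {}"
    using C by (auto simp: irreducible_closedin_def)
  have sub: "C \<subseteq> hereditary_submodules"
    using closedin_subset[OF closed] by (simp only: topspace_hereditary_submodules)
  have "\<Inter>C \<in> hereditary_submodules"
    using sub by (rule Inter_hereditary_submodules)
  moreover have "openin hereditary_topology (hereditary_submodules - C)"
    using closed topspace_hereditary_submodules by (metis openin_diff openin_topspace)
  ultimately obtain F where F: "finite F" "\<Inter>C \<in> avoiding F"
    "avoiding F \<subseteq> hereditary_submodules - C"
    using notin unfolding openin_hereditary_topology arbitrary_union_of_alt by blast
  have "\<exists>A\<in>(\<lambda>m. hereditary_submodules - avoiding {m}) ` F. C \<subseteq> A"
  proof (rule irreducible_closedin_finite_Union[OF C])
    show "finite ((\<lambda>m. hereditary_submodules - avoiding {m}) ` F)"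
      using F(1) by simp
    show "closedin hereditary_topology A"
      if A: "A \<in> (\<lambda>m. hereditary_submodules - avoiding {m}) ` F" for A
    proof -
      obtain m where "A = hereditary_submodules - avoiding {m}"
        using A by blast
      then have "A = topspace hereditary_topology - avoiding {m}"
        by (simp only: topspace_hereditary_submodules)
      then show ?thesis
        using closedin_diff[OF closedin_topspace openin_avoiding[of "{m}"]] by simp
    qed
    show "C \<subseteq> \<Union>((\<lambda>m. hereditary_submodules - avoiding {m}) ` F)"
    proof
      fix N
      assume "N \<in> C"
      then have "N \<in> hereditary_submodules" "N \<notin> avoiding F"
        using sub F(3) by blast+
      then show "N \<in> \<Union>((\<lambda>m. hereditary_submodules - avoiding {m}) ` F)"
        by (auto simp: avoiding_def)
    qed
  qed
  then show False
    using F(2) by (auto simp: avoiding_def)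
qed

lemma irreducible_closedin_hereditary_topology_generic_point:
  assumes C: "irreducible_closedin hereditary_topology C"
  shows "\<exists>!I. I \<in> C \<and> hereditary_topology closure_of {I} = C"
proof (rule ex1I[of _ "\<Inter>C"])
  have closed: "closedin hereditary_topology C"
    using C by (simp add: irreducible_closedin_def)
  have sub: "C \<subseteq> hereditary_submodules"
    using closedin_subset[OF closed] by (simp only: topspace_hereditary_submodules)
  have mem: "\<Inter>C \<in> C"
    by (rule irreducible_closedin_hereditary_topology_Inter[OF C])
  then have "hereditary_topology closure_of {\<Inter>C} \<subseteq> C"
    using closed by (simp add: closure_of_minimal)
  moreover have "C \<subseteq> hereditary_topology closure_of {\<Inter>C}"
    using mem sub closure_of_hereditary_submodule[of "\<Inter>C"] by auto
  ultimately show "\<Inter>C \<in> C \<and> hereditary_topology closure_of {\<Inter>C} = C"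
    using mem by blast
  fix I
  assume I: "I \<in> C \<and> hereditary_topology closure_of {I} = C"
  \<comment> \<open>Any generic point is thus the least member of \<open>C\<close>, which forces
    uniqueness.\<close>
  then have "C = {N \<in> hereditary_submodules. I \<subseteq> N}"
    using closure_of_hereditary_submodule sub by blast
  then show "I = \<Inter>C"
    using I by blast
qed

end

theorem corollary11p5:
  fixes act :: "'h::heyting_algebra \<Rightarrow> 'm::bounded_semilattice_sup_bot \<Rightarrow> 'm"
  assumes "heyting_module act"
  shows "spectral_space (subtopology (submodule_topology act) hereditary_submodules)"
proof -
  interpret heyting_module act by fact
  \<comment> \<open>The whole space is the basic set \<open>avoiding {}\<close>.\<close>
  have compact: "compact_space hereditary_topology"
    using compactin_avoiding[of "{}"]
    by (simp only: compact_space_def avoiding_empty topspace_hereditary_submodules finite.emptyI)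
  have "(\<lambda>U. openin hereditary_topology U \<and> compactin hereditary_topology U) (avoiding F)"
    if "finite F" for F :: "'m set"
    using that openin_avoiding compactin_avoiding by blast
  \<comment> \<open>The sets \<open>avoiding F\<close> with \<open>F\<close> finite form a basis and
    are compact open, so every open set is a union of compact open sets.\<close>
  then have "(arbitrary union_of
      (\<lambda>U. openin hereditary_topology U \<and> compactin hereditary_topology U)) U"
    if "openin hereditary_topology U" for U
    using that[unfolded openin_hereditary_topology] by (elim union_of_mono) blast
  moreover have "openin hereditary_topology U"
    if U: "(arbitrary union_of
      (\<lambda>U. openin hereditary_topology U \<and> compactin hereditary_topology U)) U" for U
  proof -
    obtain \<U> where "U = \<Union>\<U>" "\<forall>U\<in>\<U>. openin hereditary_topology U"
      using U unfolding union_of_def by blast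
    then show ?thesis by (simp add: openin_Union)
  qed
  ultimately have basis: "openin hereditary_topology = arbitrary union_of
      (\<lambda>U. openin hereditary_topology U \<and> compactin hereditary_topology U)"
    by (intro ext iffI)
  show ?thesis
    unfolding spectral_space_def
  proof (intro conjI allI impI)
    show "compact_space hereditary_topology" by (fact compact)
    show "compactin hereditary_topology (U \<inter> V)"
      if "openin hereditary_topology U \<and> compactin hereditary_topology U \<and>
        openin hereditary_topology V \<and> compactin hereditary_topology V" for U V
      using that by (elim conjE) (rule compactin_hereditary_topology_Int)
    show "openin hereditary_topology = arbitrary union_of
        (\<lambda>U. openin hereditary_topology U \<and> compactin hereditary_topology U)"
      by (fact basis)
    show "\<exists>!I. I \<in> C \<and> hereditary_topology closure_of {I} = C"
      if "irreducible_closedin hereditary_topology C" for C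
      using that by (rule irreducible_closedin_hereditary_topology_generic_point)
  qed
qed

end
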